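(* Let $f,g:\mathbb{R}^n\to(-\infty,\infty]$, $F=f+g$, satisfy the standing assumptions listed in the context, with $L$ the Lipschitz constant of $\nabla f$. Assume that the step-size $\gamma>0$ satisfies $\gamma<\frac1L$. Let the sequence $\{x^k\}$ be generated by the proximal gradient (PG) method with step-size $\gamma$, with $\bar x$ as an accumulation point. Then $\bar x\in\mathcal{X}^\pi$, and the sequence $\{x^k\}$ converges to $\bar x$ linearly if the proper separation of stationary value holds at $\bar x$ (there exists $\epsilon>0$ such that $x\in\mathcal{X}^\pi\cap\mathbb{B}(\bar x,\epsilon)$ implies $F(x)=F(\bar x)$) and the set-valued map $$\mathcal{S}_{cano}(p):=\{x: p\in\nabla f(x)+\partial^\pi g(x)\}$$ is calm at $(0,\bar x)$.
   Context: Standing assumptions. $f,g:\mathbb{R}^n\to(-\infty,\infty]$ are proper lower semicontinuous functions, $F:=f+g$, and $\mathrm{dom}\,\phi:=\{x:\phi(x)<\infty\}$. The function $f$ is smooth on $\mathrm{dom} f$, which is assumed to be open, and $\nabla f$ is Lipschitz continuous with constant $L>0$ on a closed set $C\supseteq\mathrm{dom} f\cap\mathrm{dom} g$. The function $g$ is continuous in $\mathrm{dom} g$. $F(x)\ge F_{\min}$ for all $x\in\mathbb{R}^n$. The function $g$ is prox-bounded, meaning that the (possibly set-valued) proximal operator $\mathrm{Prox}_g^\gamma(a):=\arg\min_{x\in\mathbb{R}^n}\{g(x)+\frac1{2\gamma}\|x-a\|^2\}$ is well-defined when $\gamma$ is selected with $0<\gamma<\gamma_g$, for a certain $\gamma_g>0$.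 PG method with step-size $\gamma$: $x^{k+1}\in\mathrm{Prox}_g^\gamma(x^k-\gamma\nabla f(x^k))$ for $k=0,1,2,\dots$ Proximal subdifferential: for $x_0\in\mathrm{dom}\,\phi$, $\partial^\pi\phi(x_0)$ is the set of $\xi$ for which there exist $\sigma,\eta>0$ with $\phi(x)\ge\phi(x_0)+\langle\xi,x-x_0\rangle-\sigma\|x-x_0\|^2$ for all $x\in\mathbb{B}(x_0,\eta)$. $\mathcal{X}^\pi:=\{x: 0\in\nabla f(x)+\partial^\pi g(x)\}$ is the set of proximal stationary points. $\mathbb{B}(x,r)$ is the open ball of radius $r$ centred at $x$. Calmness: $\mathcal{S}:\mathbb{R}^s\rightrightarrows\mathbb{R}^d$ is calm at $(\bar p,\bar x)$, $\bar x\in\mathcal{S}(\bar p)$, if there exist neighborhoods $\mathbb{U}(\bar p)$ of $\bar p$ and $\mathbb{U}(\bar x)$ of $\bar x$ and $\kappa\ge0$ such that $\mathcal{S}(p)\cap\mathbb{U}(\bar x)\subseteq\mathcal{S}(\bar p)+\kappa\|p-\bar p\|\overline{\mathbb{B}}$ for all $p\in\mathbb{U}(\bar p)$, with $\overline{\mathbb{B}}$ the closed unit ball. "Converges to $\bar x$ linearly" is understood as: there exist $k_0>0$, $0<\sigma<1$, $\rho_0>0$, $0<\rho<1$ such that for all $k\ge k_0$, $F(x^{k+1})-F(\bar x)\le\sigma(F(x^k)-F(\bar x))$ and $\|x^k-\bar x\|\le\rho_0\rho^k$.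
   Formalization: The closed set C on which the gradient of f is L-Lipschitz is additionally assumed convex; for nonconvex C (e.g. nine points on a circle) the PG iterates can cycle although calmness and separation hold, so the claim fails. *)

theory Defs
  imports "HOL-Analysis.Analysis"
begin

text \<open>Extended-real-valued functions have type \<open>'a \<Rightarrow> ereal\<close>; properness excludes the value \<open>- \<infinity>\<close>.\<close>

definition edom :: "('a \<Rightarrow> ereal) \<Rightarrow> 'a set" where
  "edom \<phi> = {x. \<phi> x < \<infinity>}"

definition proper_fun :: "('a \<Rightarrow> ereal) \<Rightarrow> bool" where
  "proper_fun \<phi> \<longleftrightarrow> (\<forall>x. \<phi> x \<noteq> - \<infinity>) \<and> edom \<phi> \<noteq> {}"

definition lsc_fun :: "('a::topological_space \<Rightarrow> ereal) \<Rightarrow> bool" where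
  "lsc_fun \<phi> \<longleftrightarrow> (\<forall>x. \<phi> x \<le> Liminf (at x) \<phi>)"

text \<open>
  \<open>real_of_ereal\<close> sends infinite values to \<open>0\<close>. The interior condition makes that irrelevant:
  a gradient can exist only where \<open>\<phi>\<close> is finite (for proper \<open>\<phi>\<close>) on a whole neighbourhood.
\<close>

definition has_grad :: "('a::real_inner \<Rightarrow> ereal) \<Rightarrow> 'a \<Rightarrow> 'a \<Rightarrow> bool" where
  "has_grad \<phi> x v \<longleftrightarrow> x \<in> interior (edom \<phi>) \<and> GDERIV (\<lambda>y. real_of_ereal (\<phi> y)) x :> v"

definition grad :: "('a::real_inner \<Rightarrow> ereal) \<Rightarrow> 'a \<Rightarrow> 'a" where
  "grad \<phi> x = (THE v. has_grad \<phi> x v)"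

lemma grad_eq: "grad \<phi> x = v" if "has_grad \<phi> x v"
proof -
  have "w = v" if w: "has_grad \<phi> x w" for w
  proof -
    have "(\<lambda>h. inner h w) = (\<lambda>h. inner h v)"
      using w \<open>has_grad \<phi> x v\<close> unfolding has_grad_def gderiv_def
      by (metis has_derivative_unique)
    then show ?thesis
      by (metis inner_commute vector_eq_ldot)
  qed
  with that show ?thesis
    unfolding grad_def by blast
qed

text \<open>``Smooth'' means continuously differentiable.\<close>

definition smooth_on_dom :: "('a::real_inner \<Rightarrow> ereal) \<Rightarrow> bool" where
  "smooth_on_dom \<phi> \<longleftrightarrow>
     (\<forall>x\<in>edom \<phi>. \<exists>v. has_grad \<phi> x v) \<and> continuous_on (edom \<phi>) (grad \<phi>)"

text \<open>Lipschitz continuity of the gradient on \<open>C\<close> includes its existence at every point of \<open>C\<close>.\<close>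

definition grad_lipschitz_on :: "real \<Rightarrow> 'a::real_inner set \<Rightarrow> ('a \<Rightarrow> ereal) \<Rightarrow> bool" where
  "grad_lipschitz_on L C \<phi> \<longleftrightarrow>
     (\<forall>x\<in>C. \<exists>v. has_grad \<phi> x v) \<and> L-lipschitz_on C (grad \<phi>)"

definition Prox :: "('a::real_normed_vector \<Rightarrow> ereal) \<Rightarrow> real \<Rightarrow> 'a \<Rightarrow> 'a set" where
  "Prox \<phi> \<gamma> a =
     {x. is_arg_min (\<lambda>y. \<phi> y + ereal (1 / (2 * \<gamma>) * (norm (y - a))\<^sup>2)) (\<lambda>_. True) x}"

definition prox_bounded :: "('a::real_normed_vector \<Rightarrow> ereal) \<Rightarrow> bool" where
  "prox_bounded \<phi> \<longleftrightarrow>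
     (\<exists>\<gamma>\<^sub>0>0. \<forall>\<gamma>. 0 < \<gamma> \<and> \<gamma> < \<gamma>\<^sub>0 \<longrightarrow> (\<forall>a. Prox \<phi> \<gamma> a \<noteq> {}))"

text \<open>
  The iteration uses the gradient of \<open>f\<close> at every iterate, so all iterates lie in the domain
  of \<open>f\<close>; the starting point need not lie in the domain of \<open>g\<close>.
\<close>

definition PG_sequence ::
    "('a::real_inner \<Rightarrow> ereal) \<Rightarrow> ('a \<Rightarrow> ereal) \<Rightarrow> real \<Rightarrow> (nat \<Rightarrow> 'a) \<Rightarrow> bool" where
  "PG_sequence f g \<gamma> x \<longleftrightarrow>
     (\<forall>k. x k \<in> edom f \<and> x (Suc k) \<in> Prox g \<gamma> (x k - \<gamma> *\<^sub>R grad f (x k)))"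

definition seq_accumulation_point :: "(nat \<Rightarrow> 'a::topological_space) \<Rightarrow> 'a \<Rightarrow> bool" where
  "seq_accumulation_point x l \<longleftrightarrow> (\<exists>r. strict_mono r \<and> (x \<circ> r) \<longlonglongrightarrow> l)"

text \<open>The proximal subdifferential is empty outside the domain.\<close>

definition prox_subdiff :: "('a::real_inner \<Rightarrow> ereal) \<Rightarrow> 'a \<Rightarrow> 'a set" where
  "prox_subdiff \<phi> x\<^sub>0 =
     {\<xi>. x\<^sub>0 \<in> edom \<phi> \<and>
         (\<exists>\<sigma>>0. \<exists>\<eta>>0. \<forall>x\<in>ball x\<^sub>0 \<eta>.
            \<phi> x \<ge> \<phi> x\<^sub>0 + ereal (inner \<xi> (x - x\<^sub>0) - \<sigma> * (norm (x - x\<^sub>0))\<^sup>2))}"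

text \<open>The condition \<open>p \<in> \<nabla>f(x) + \<partial>g(x)\<close> is meaningful only for \<open>x\<close> in the domain of \<open>f\<close>.\<close>

definition S_cano ::
    "('a::real_inner \<Rightarrow> ereal) \<Rightarrow> ('a \<Rightarrow> ereal) \<Rightarrow> 'a \<Rightarrow> 'a set" where
  "S_cano f g p = {x \<in> edom f. p \<in> (\<lambda>\<xi>. grad f x + \<xi>) ` prox_subdiff g x}"

definition prox_stationary :: "('a::real_inner \<Rightarrow> ereal) \<Rightarrow> ('a \<Rightarrow> ereal) \<Rightarrow> 'a set" where
  "prox_stationary f g = {x \<in> edom f. 0 \<in> (\<lambda>\<xi>. grad f x + \<xi>) ` prox_subdiff g x}"

definition proper_separation ::
    "('a::real_inner \<Rightarrow> ereal) \<Rightarrow> ('a \<Rightarrow> ereal) \<Rightarrow> 'a \<Rightarrow> bool" where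
  "proper_separation f g l \<longleftrightarrow>
     (\<exists>\<epsilon>>0. \<forall>x \<in> prox_stationary f g \<inter> ball l \<epsilon>. f x + g x = f l + g l)"

definition calm_at ::
    "('p::real_normed_vector \<Rightarrow> 'x::real_normed_vector set) \<Rightarrow> 'p \<Rightarrow> 'x \<Rightarrow> bool" where
  "calm_at S p\<^sub>0 x\<^sub>0 \<longleftrightarrow> x\<^sub>0 \<in> S p\<^sub>0 \<and>
     (\<exists>U V \<kappa>. open U \<and> p\<^sub>0 \<in> U \<and> open V \<and> x\<^sub>0 \<in> V \<and> \<kappa> \<ge> 0 \<and>
        (\<forall>p\<in>U. S p \<inter> V \<subseteq> {y + (\<kappa> * norm (p - p\<^sub>0)) *\<^sub>R b | y b. y \<in> S p\<^sub>0 \<and> b \<in> cball 0 1}))"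

definition converges_linearly ::
    "('a::real_normed_vector \<Rightarrow> ereal) \<Rightarrow> (nat \<Rightarrow> 'a) \<Rightarrow> 'a \<Rightarrow> bool" where
  "converges_linearly F x l \<longleftrightarrow>
     (\<exists>k\<^sub>0>0. \<exists>\<sigma> \<rho>\<^sub>0 \<rho>. 0 < \<sigma> \<and> \<sigma> < 1 \<and> 0 < \<rho>\<^sub>0 \<and> 0 < \<rho> \<and> \<rho> < 1 \<and>
        (\<forall>k\<ge>k\<^sub>0. F (x (Suc k)) - F l \<le> ereal \<sigma> * (F (x k) - F l) \<and>
                 norm (x k - l) \<le> \<rho>\<^sub>0 * \<rho> ^ k))"

end

theory Submission
  imports Defs
begin

text \<open>
  A proximal gradient step satisfies, for every \<open>y\<close> in the domain of \<open>g\<close>, the estimate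
  \<open>F(x\<^sup>+) \<le> F(y) + (1/\<gamma> + L)/2 \<parallel>y - x\<parallel>\<^sup>2 - (1/\<gamma> - L)/2 \<parallel>x\<^sup>+ - x\<parallel>\<^sup>2\<close>.
  With \<open>y = x\<close> this is sufficient descent, so the steps tend to zero and closedness of the graph of
  the proximal operator makes every accumulation point stationary. The optimality condition of the
  step puts \<open>x\<^sup>+\<close> into \<open>S\<^sub>c\<^sub>a\<^sub>n\<^sub>o(p)\<close> with \<open>\<parallel>p\<parallel> \<le> (L + 1/\<gamma>) \<parallel>x\<^sup>+ - x\<parallel>\<close>. Near \<open>xbar\<close>, calmness gives a
  stationary point \<open>y\<close> whose distance to \<open>x\<^sup>+\<close> is of the order of the step, and by separation \<open>F(y) = F(xbar)\<close>.
  The estimate for this \<open>y\<close> bounds \<open>F(x\<^sup>+) - F(xbar)\<close> by a multiple of the descent: the values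
  contract. The steps are bounded by the square root of the value gap, so once the iterates are close
  enough to \<open>xbar\<close> they cannot leave its neighbourhood, and the contraction persists.
\<close>

section \<open>Extended-real values and lower semicontinuity\<close>

lemma edom_ereal_real:
  assumes "proper_fun \<phi>" "x \<in> edom \<phi>"
  shows "\<phi> x = ereal (real_of_ereal (\<phi> x))"
  using assms by (cases "\<phi> x") (auto simp: proper_fun_def edom_def)

lemma lsc_fun_le_tendsto:
  fixes \<phi> :: "'a::topological_space \<Rightarrow> ereal"
  assumes lsc: "lsc_fun \<phi>" and lim: "X \<longlonglongrightarrow> x" "b \<longlonglongrightarrow> c" and le: "\<And>i. \<phi> (X i) \<le> b i"
  shows "\<phi> x \<le> c"
proof (rule ccontr)
  assume "\<not> \<phi> x \<le> c"
  then obtain d where d: "c < d" "d < \<phi> x"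
    using dense[of c "\<phi> x"] by (auto simp: not_le)
  have "d < Liminf (at x) \<phi>"
    using lsc d(2) unfolding lsc_fun_def by (metis less_le_trans)
  then have "\<forall>\<^sub>F y in at x. d < \<phi> y"
    by (rule less_LiminfD)
  \<comment> \<open>\<open>lsc_fun\<close> speaks of the punctured filter \<open>at x\<close>, while
    the sequence may visit \<open>x\<close> itself; there \<open>d < \<phi> x\<close> supplies the
    bound.\<close>
  then have "\<forall>\<^sub>F y in nhds x. d < \<phi> y"
    using d(2) by (auto simp: eventually_at_filter elim!: eventually_mono)
  then have "\<forall>\<^sub>F i in sequentially. d < \<phi> (X i)"
    using lim(1) by (rule eventually_compose_filterlim)
  moreover have "\<forall>\<^sub>F i in sequentially. b i < d"
    using lim(2) d(1) by (rule order_tendstoD)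
  ultimately have "\<forall>\<^sub>F i::nat in sequentially. False"
    by eventually_elim (use le in \<open>meson leD less_le_trans less_trans\<close>)
  then show False by simp
qed

section \<open>The proximal operator\<close>

text \<open>Turns the extended-real minimization into real inequalities: competitors outside the
  domain have value \<open>\<infinity>\<close>, and properness provides a finite competitor
  \<open>z\<close>, which forces a minimizer into the domain.\<close>

lemma Prox_iff:
  assumes "proper_fun \<phi>"
  shows "x \<in> Prox \<phi> \<gamma> a \<longleftrightarrow> x \<in> edom \<phi> \<and>
    (\<forall>y\<in>edom \<phi>. real_of_ereal (\<phi> x) + 1 / (2 * \<gamma>) * (norm (x - a))\<^sup>2
      \<le> real_of_ereal (\<phi> y) + 1 / (2 * \<gamma>) * (norm (y - a))\<^sup>2)"
proof -
  let ?q = "\<lambda>y. 1 / (2 * \<gamma>) * (norm (y - a))\<^sup>2"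
  have eq: "\<phi> y + ereal (?q y) = ereal (real_of_ereal (\<phi> y) + ?q y)" if "y \<in> edom \<phi>" for y
    by (subst edom_ereal_real[OF assms that]) simp
  have infin: "\<phi> y + ereal (?q y) = \<infinity>" if "y \<notin> edom \<phi>" for y
    using that by (auto simp: edom_def)
  obtain z where z: "z \<in> edom \<phi>"
    using assms by (auto simp: proper_fun_def)
  have mem: "x \<in> Prox \<phi> \<gamma> a \<longleftrightarrow> (\<forall>y. \<phi> x + ereal (?q x) \<le> \<phi> y + ereal (?q y))"
    by (auto simp: Prox_def is_arg_min_def not_less)
  show ?thesis
  proof
    assume A: "x \<in> Prox \<phi> \<gamma> a"
    have x: "x \<in> edom \<phi>"
      using A[unfolded mem, rule_format, of z] infin[of x] unfolding eq[OF z] by fastforce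
    have "real_of_ereal (\<phi> x) + ?q x \<le> real_of_ereal (\<phi> y) + ?q y" if "y \<in> edom \<phi>" for y
      using A[unfolded mem, rule_format, of y] unfolding eq[OF x] eq[OF that] ereal_less_eq .
    with x show "x \<in> edom \<phi> \<and>
        (\<forall>y\<in>edom \<phi>. real_of_ereal (\<phi> x) + ?q x \<le> real_of_ereal (\<phi> y) + ?q y)"
      by blast
  next
    assume A: "x \<in> edom \<phi> \<and>
        (\<forall>y\<in>edom \<phi>. real_of_ereal (\<phi> x) + ?q x \<le> real_of_ereal (\<phi> y) + ?q y)"
    have "\<phi> x + ereal (?q x) \<le> \<phi> y + ereal (?q y)" for y
    proof (cases "y \<in> edom \<phi>")
      case True
      with A show ?thesis by (simp only: eq ereal_less_eq)
    next
      case False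
      then show ?thesis by (simp add: edom_def)
    qed
    then show "x \<in> Prox \<phi> \<gamma> a"
      by (simp add: mem)
  qed
qed

text \<open>Minimality against a fixed \<open>y\<close> bounds \<open>\<phi> (X i)\<close> by a
  quantity continuous in \<open>X i\<close> and \<open>A i\<close>; lower semicontinuity carries
  this bound to the limit.\<close>

lemma Prox_closed_graph:
  fixes \<phi> :: "'a::real_normed_vector \<Rightarrow> ereal"
  assumes proper: "proper_fun \<phi>" and lsc: "lsc_fun \<phi>"
    and lim: "X \<longlonglongrightarrow> x" "A \<longlonglongrightarrow> a" and prox: "\<And>i. X i \<in> Prox \<phi> \<gamma> (A i)"
  shows "x \<in> Prox \<phi> \<gamma> a"
proof -
  have X: "X i \<in> edom \<phi>" for i
    using prox Prox_iff[OF proper] by blast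
  have le: "\<phi> x \<le> ereal (real_of_ereal (\<phi> y) + 1 / (2 * \<gamma>) * (norm (y - a))\<^sup>2
      - 1 / (2 * \<gamma>) * (norm (x - a))\<^sup>2)" if y: "y \<in> edom \<phi>" for y
  proof (rule lsc_fun_le_tendsto[OF lsc lim(1)])
    show "(\<lambda>i. ereal (real_of_ereal (\<phi> y) + 1 / (2 * \<gamma>) * (norm (y - A i))\<^sup>2
        - 1 / (2 * \<gamma>) * (norm (X i - A i))\<^sup>2)) \<longlonglongrightarrow>
      ereal (real_of_ereal (\<phi> y) + 1 / (2 * \<gamma>) * (norm (y - a))\<^sup>2
        - 1 / (2 * \<gamma>) * (norm (x - a))\<^sup>2)"
      by (intro tendsto_intros lim)
    show "\<phi> (X i) \<le> ereal (real_of_ereal (\<phi> y) + 1 / (2 * \<gamma>) * (norm (y - A i))\<^sup>2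
        - 1 / (2 * \<gamma>) * (norm (X i - A i))\<^sup>2)" for i
    proof (subst edom_ereal_real[OF proper X])
      have "real_of_ereal (\<phi> (X i)) + 1 / (2 * \<gamma>) * (norm (X i - A i))\<^sup>2
          \<le> real_of_ereal (\<phi> y) + 1 / (2 * \<gamma>) * (norm (y - A i))\<^sup>2"
        using prox[of i] y unfolding Prox_iff[OF proper] by blast
      then show "ereal (real_of_ereal (\<phi> (X i))) \<le> ereal (real_of_ereal (\<phi> y)
          + 1 / (2 * \<gamma>) * (norm (y - A i))\<^sup>2 - 1 / (2 * \<gamma>) * (norm (X i - A i))\<^sup>2)"
        by (simp add: le_diff_eq)
    qed
  qed
  \<comment> \<open>Any domain point would do as competitor; \<open>X 0\<close> is one at
    hand.\<close>
  have x: "x \<in> edom \<phi>"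
    using le[OF X[of 0]] by (cases "\<phi> x") (auto simp: edom_def)
  have "real_of_ereal (\<phi> x) + 1 / (2 * \<gamma>) * (norm (x - a))\<^sup>2
      \<le> real_of_ereal (\<phi> y) + 1 / (2 * \<gamma>) * (norm (y - a))\<^sup>2" if "y \<in> edom \<phi>" for y
    using le[OF that] by (subst (asm) edom_ereal_real[OF proper x]) (simp add: le_diff_eq)
  with x show ?thesis
    unfolding Prox_iff[OF proper] by blast
qed

text \<open>Expanding the squares in the minimality inequality leaves a global quadratic minorant
  touching \<open>\<phi>\<close> at \<open>x\<close>, so \<open>1 / (2 * \<gamma>)\<close> serves as
  \<open>\<sigma>\<close> and any radius as \<open>\<eta>\<close>.\<close>

lemma Prox_imp_prox_subdiff:
  fixes \<phi> :: "'a::real_inner \<Rightarrow> ereal"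
  assumes proper: "proper_fun \<phi>" and "\<gamma> > 0" and prox: "x \<in> Prox \<phi> \<gamma> a"
  shows "(1 / \<gamma>) *\<^sub>R (a - x) \<in> prox_subdiff \<phi> x"
proof -
  have x: "x \<in> edom \<phi>"
    using prox Prox_iff[OF proper] by blast
  have "\<phi> x + ereal (inner ((1 / \<gamma>) *\<^sub>R (a - x)) (y - x) - 1 / (2 * \<gamma>) * (norm (y - x))\<^sup>2) \<le> \<phi> y" for y
  proof (cases "y \<in> edom \<phi>")
    case True
    then have "real_of_ereal (\<phi> x) + 1 / (2 * \<gamma>) * (norm (x - a))\<^sup>2
      \<le> real_of_ereal (\<phi> y) + 1 / (2 * \<gamma>) * (norm (y - a))\<^sup>2"
      using prox unfolding Prox_iff[OF proper] by blast
    moreover have "1 / (2 * \<gamma>) * (norm (y - a))\<^sup>2 - 1 / (2 * \<gamma>) * (norm (x - a))\<^sup>2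
      = 1 / (2 * \<gamma>) * (norm (y - x))\<^sup>2 - inner ((1 / \<gamma>) *\<^sub>R (a - x)) (y - x)"
      using \<open>\<gamma> > 0\<close>
      by (simp add: power2_norm_eq_inner inner_diff_left inner_diff_right inner_commute field_simps)
    ultimately show ?thesis
      by (subst edom_ereal_real[OF proper x], subst edom_ereal_real[OF proper True]) simp
  next
    case False
    then show ?thesis by (simp add: edom_def)
  qed
  moreover have "1 / (2 * \<gamma>) > 0"
    using \<open>\<gamma> > 0\<close> by simp
  ultimately show ?thesis
    unfolding prox_subdiff_def using x zero_less_one[where ?'a = real] by blast
qed

section \<open>Quadratic bounds and the proximal gradient step\<close>

lemma lipschitz_gradient_upper_bound:
  fixes h :: "'a::real_inner \<Rightarrow> real"
  assumes "convex C" and deriv: "\<And>z. z \<in> C \<Longrightarrow> GDERIV h z :> G z"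
    and lip: "L-lipschitz_on C G" and C: "x \<in> C" "y \<in> C"
  shows "h y \<le> h x + inner (G x) (y - x) + L / 2 * (norm (y - x))\<^sup>2"
proof -
  define z where "z = (\<lambda>t::real. x + t *\<^sub>R (y - x))"
  \<comment> \<open>\<open>\<psi>\<close> is \<open>h\<close> along the segment minus the
    non-constant part of the quadratic bound, so the claim is
    \<open>\<psi> 1 \<le> \<psi> 0\<close>; Cauchy-Schwarz and the Lipschitz condition make its
    derivative nonpositive.\<close>
  define \<psi> where "\<psi> = (\<lambda>t. h (z t) - t * inner (G x) (y - x) - L / 2 * t\<^sup>2 * (norm (y - x))\<^sup>2)"
  have zC: "z t \<in> C" if "0 \<le> t" "t \<le> 1" for t
    using \<open>convex C\<close> C that unfolding z_def convex_alt
    by (metis (no_types, lifting) add_diff_eq convex_alt diff_add_eq scaleR_left_diff_distrib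
        scaleR_one scaleR_right_diff_distrib add.commute)
  have "\<psi> 1 \<le> \<psi> 0"
  proof (rule DERIV_nonpos_imp_nonincreasing[where f = \<psi>])
    fix t :: real assume t: "0 \<le> t" "t \<le> 1"
    have "(z has_derivative (\<lambda>s. s *\<^sub>R (y - x))) (at t)"
      unfolding z_def by (auto intro!: derivative_eq_intros)
    from has_derivative_compose[OF this deriv[OF zC[OF t], unfolded gderiv_def]]
    have "((\<lambda>t. h (z t)) has_real_derivative inner (G (z t)) (y - x)) (at t)"
      by (simp add: has_field_derivative_def inner_commute mult_commute_abs)
    then have D: "(\<psi> has_real_derivative
        inner (G (z t)) (y - x) - inner (G x) (y - x) - L * t * (norm (y - x))\<^sup>2) (at t)"
      unfolding \<psi>_def by (auto intro!: derivative_eq_intros)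
    have "inner (G (z t)) (y - x) - inner (G x) (y - x) = inner (G (z t) - G x) (y - x)"
      by (simp add: inner_diff_left)
    also have "\<dots> \<le> norm (G (z t) - G x) * norm (y - x)"
      by (rule norm_cauchy_schwarz)
    also have "\<dots> \<le> (L * (t * norm (y - x))) * norm (y - x)"
      using lipschitz_onD[OF lip zC[OF t] C(1)] t
      by (intro mult_right_mono) (simp_all add: dist_norm z_def)
    finally have "inner (G (z t)) (y - x) - inner (G x) (y - x) - L * t * (norm (y - x))\<^sup>2 \<le> 0"
      by (simp add: power2_eq_square mult_ac)
    with D show "\<exists>d. (\<psi> has_real_derivative d) (at t) \<and> d \<le> 0"
      by blast
  qed simp
  then show ?thesis
    by (simp add: \<psi>_def z_def)
qed

text \<open>This is the upper bound for \<open>- h\<close>, whose gradient \<open>- G\<close> has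
  the same Lipschitz constant.\<close>

lemma lipschitz_gradient_lower_bound:
  fixes h :: "'a::real_inner \<Rightarrow> real"
  assumes "convex C" and deriv: "\<And>z. z \<in> C \<Longrightarrow> GDERIV h z :> G z"
    and lip: "L-lipschitz_on C G" and C: "x \<in> C" "y \<in> C"
  shows "h x + inner (G x) (y - x) \<le> h y + L / 2 * (norm (y - x))\<^sup>2"
proof -
  have "- h y \<le> - h x + inner (- G x) (y - x) + L / 2 * (norm (y - x))\<^sup>2"
    using assms by (intro lipschitz_gradient_upper_bound[where C = C and G = "\<lambda>z. - G z"])
      (auto intro!: GDERIV_minus lipschitz_on_minus)
  then show ?thesis by simp
qed

text \<open>Add minimality of \<open>x'\<close> against \<open>y\<close>, the upper bound at
  \<open>x'\<close> and the lower bound at \<open>y\<close>; the linear terms and \<open>h x\<close>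
  cancel. The free \<open>y\<close> permits comparison both with \<open>x\<close> and with a nearby
  stationary point.\<close>

lemma prox_gradient_step_le:
  fixes h :: "'a::real_inner \<Rightarrow> real"
  assumes "convex C" and "\<And>z. z \<in> C \<Longrightarrow> GDERIV h z :> G z" and "L-lipschitz_on C G"
    and proper: "proper_fun \<phi>" and "\<gamma> > 0" and prox: "x' \<in> Prox \<phi> \<gamma> (x - \<gamma> *\<^sub>R G x)"
    and C: "x \<in> C" "x' \<in> C" "y \<in> C" and y: "y \<in> edom \<phi>"
  shows "h x' + real_of_ereal (\<phi> x') \<le> h y + real_of_ereal (\<phi> y)
    + (1 / \<gamma> + L) / 2 * (norm (y - x))\<^sup>2 - (1 / \<gamma> - L) / 2 * (norm (x' - x))\<^sup>2"
proof -
  \<comment> \<open>The last summand does not depend on \<open>z\<close>, so it cancels when two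
    competitors are compared.\<close>
  have sq: "1 / (2 * \<gamma>) * (norm (z - (x - \<gamma> *\<^sub>R G x)))\<^sup>2
      = 1 / (2 * \<gamma>) * (norm (z - x))\<^sup>2 + inner (G x) (z - x) + \<gamma> / 2 * (norm (G x))\<^sup>2" for z
    using \<open>\<gamma> > 0\<close>
    by (simp add: power2_norm_eq_inner inner_simps inner_commute field_simps)
  have "real_of_ereal (\<phi> x') + 1 / (2 * \<gamma>) * (norm (x' - x))\<^sup>2 + inner (G x) (x' - x)
      \<le> real_of_ereal (\<phi> y) + 1 / (2 * \<gamma>) * (norm (y - x))\<^sup>2 + inner (G x) (y - x)"
    using prox y unfolding Prox_iff[OF proper] sq by force
  moreover have "h x' \<le> h x + inner (G x) (x' - x) + L / 2 * (norm (x' - x))\<^sup>2"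
    using assms by (intro lipschitz_gradient_upper_bound)
  moreover have "h x + inner (G x) (y - x) \<le> h y + L / 2 * (norm (y - x))\<^sup>2"
    using assms by (intro lipschitz_gradient_lower_bound)
  moreover have "(1 / \<gamma> + L) / 2 * (norm (y - x))\<^sup>2
      = 1 / (2 * \<gamma>) * (norm (y - x))\<^sup>2 + L / 2 * (norm (y - x))\<^sup>2"
    by (simp add: field_simps)
  moreover have "(1 / \<gamma> - L) / 2 * (norm (x' - x))\<^sup>2
      = 1 / (2 * \<gamma>) * (norm (x' - x))\<^sup>2 - L / 2 * (norm (x' - x))\<^sup>2"
    by (simp add: field_simps)
  ultimately show ?thesis by linarith
qed

section \<open>Calmness as an error bound, and local linear convergence\<close>

lemma calm_at_error_bound:
  assumes "calm_at S 0 l"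
  obtains \<delta> \<kappa> where "\<delta> > 0" "\<kappa> \<ge> 0"
    and "\<And>p x. norm p < \<delta> \<Longrightarrow> dist x l < \<delta> \<Longrightarrow> x \<in> S p \<Longrightarrow> \<exists>y\<in>S 0. norm (x - y) \<le> \<kappa> * norm p"
proof -
  obtain U V \<kappa> where U: "open U" "0 \<in> U" and V: "open V" "l \<in> V" and \<kappa>: "\<kappa> \<ge> 0"
    and S: "\<And>p. p \<in> U \<Longrightarrow>
      S p \<inter> V \<subseteq> {y + (\<kappa> * norm (p - 0)) *\<^sub>R b | y b. y \<in> S 0 \<and> b \<in> cball 0 1}"
    using assms unfolding calm_at_def
    by (elim conjE exE) (rule that; (assumption | erule (1) bspec))
  obtain u where u: "u > 0" "ball 0 u \<subseteq> U"
    using U open_contains_ball by blast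
  obtain v where v: "v > 0" "ball l v \<subseteq> V"
    using V open_contains_ball by blast
  show thesis
  proof (rule that[of "min u v" \<kappa>])
    fix p x assume p: "norm p < min u v" and x: "dist x l < min u v" "x \<in> S p"
    have "p \<in> U" "x \<in> V"
      using p x u v by (auto simp: dist_commute)
    with S[of p] x obtain y b where y: "x = y + (\<kappa> * norm p) *\<^sub>R b" "y \<in> S 0" "norm b \<le> 1"
      by auto
    have "norm (x - y) = \<kappa> * norm p * norm b"
      using \<kappa> y(1) by (simp add: abs_mult)
    also have "\<dots> \<le> \<kappa> * norm p"
      using \<kappa> y(3) by (intro mult_left_le) auto
    finally show "\<exists>y\<in>S 0. norm (x - y) \<le> \<kappa> * norm p"
      using y(2) by blast
  qed (use u v \<kappa> in auto)
qed

text \<open>Telescoping and the geometric series. Only the first \<open>j\<close> steps are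
  constrained, so the bound is available inside an induction that has controlled only finitely many
  steps.\<close>

lemma norm_geometric_steps_le:
  fixes y :: "nat \<Rightarrow> 'a::real_normed_vector"
  assumes s: "0 \<le> s" "s < 1" and "0 \<le> c"
    and step: "\<And>i. i < j \<Longrightarrow> norm (y (Suc (n + i)) - y (n + i)) \<le> c * s ^ (n + i)"
  shows "norm (y (n + j) - y n) \<le> c * s ^ n / (1 - s)"
proof -
  have "y (n + j) - y n = (\<Sum>i<j. y (n + Suc i) - y (n + i))"
    by (subst sum_lessThan_telescope) simp
  then have "norm (y (n + j) - y n) \<le> (\<Sum>i<j. norm (y (n + Suc i) - y (n + i)))"
    by (simp only: norm_sum)
  also have "\<dots> \<le> (\<Sum>i<j. c * s ^ (n + i))"
    using step by (intro sum_mono) auto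
  also have "\<dots> = c * s ^ n * (\<Sum>i<j. s ^ i)"
    by (simp add: sum_distrib_left power_add mult.assoc)
  also have "\<dots> = c * s ^ n * ((1 - s ^ j) / (1 - s))"
    using s by (simp add: sum_gp_strict)
  also have "\<dots> \<le> c * s ^ n * (1 / (1 - s))"
    using s \<open>0 \<le> c\<close> by (intro mult_left_mono divide_right_mono) auto
  finally show ?thesis by simp
qed

text \<open>A bootstrap for value gaps \<open>a\<close>: contraction is given only while the next
  iterate is near \<open>l\<close>, but contraction up to now makes the path so short that the next
  iterate is still near. Steps are of order \<open>sqrt (a k)\<close>, whence the rate
  \<open>sqrt \<sigma>\<close>.\<close>

lemma local_linear_convergence:
  fixes x :: "nat \<Rightarrow> 'a::real_normed_vector" and a :: "nat \<Rightarrow> real"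
  assumes a: "\<And>k. k \<ge> N \<Longrightarrow> 0 \<le> a k"
    and step: "\<And>k. k \<ge> N \<Longrightarrow> (norm (x (Suc k) - x k))\<^sup>2 \<le> M * a k"
    and contr: "\<And>k. k \<ge> N \<Longrightarrow> dist (x (Suc k)) l < \<delta> \<Longrightarrow> a (Suc k) \<le> \<sigma> * a k"
    and \<sigma>: "0 < \<sigma>" "\<sigma> < 1" and "0 < \<delta>" "0 \<le> M"
    and r: "strict_mono r" "(x \<circ> r) \<longlonglongrightarrow> l" "(a \<circ> r) \<longlonglongrightarrow> 0"
  obtains K \<rho>\<^sub>0 where "K \<ge> N" "\<rho>\<^sub>0 > 0"
    and "\<And>k. k \<ge> K \<Longrightarrow> a (Suc k) \<le> \<sigma> * a k \<and> norm (x k - l) \<le> \<rho>\<^sub>0 * sqrt \<sigma> ^ k"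
proof -
  define s where "s = sqrt \<sigma>"
  have s: "0 < s" "s < 1"
    using \<sigma> by (auto simp: s_def)
  have "(\<lambda>i. sqrt (M * (a \<circ> r) i) / (1 - s)) \<longlonglongrightarrow> sqrt (M * 0) / (1 - s)"
    using s by (intro tendsto_intros r) auto
  then have "\<forall>\<^sub>F i in sequentially. sqrt (M * a (r i)) / (1 - s) < \<delta> / 2"
    using \<open>0 < \<delta>\<close> by (intro order_tendstoD(2)) auto
  moreover have "\<forall>\<^sub>F i in sequentially. dist (x (r i)) l < \<delta> / 2"
    using tendstoD[OF r(2), of "\<delta> / 2"] \<open>0 < \<delta>\<close> by simp
  ultimately have "\<forall>\<^sub>F i in sequentially. sqrt (M * a (r i)) / (1 - s) < \<delta> / 2
      \<and> dist (x (r i)) l < \<delta> / 2 \<and> i \<ge> N"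
    using eventually_ge_at_top[of N] by eventually_elim auto
  then obtain i where i: "sqrt (M * a (r i)) / (1 - s) < \<delta> / 2" "dist (x (r i)) l < \<delta> / 2" "i \<ge> N"
    using eventually_sequentially by auto
  \<comment> \<open>From this index on, half of \<open>\<delta>\<close> covers the distance to
    \<open>l\<close> and the other half the total length of all later steps.\<close>
  define K where "K = r i"
  have K: "K \<ge> N"
    using i(3) seq_suble[OF r(1), of i] by (simp add: K_def)
  define c where "c = sqrt (M * a K)"
  have c: "0 \<le> c" "c / (1 - s) < \<delta> / 2"
    using i(1) a[OF K] \<open>0 \<le> M\<close> by (auto simp: c_def K_def)
  define y where "y = (\<lambda>n. x (K + n))"
  have y_step: "norm (y (Suc n) - y n) \<le> c * s ^ n" if "a (K + n) \<le> \<sigma> ^ n * a K" for n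
  proof -
    have "(norm (y (Suc n) - y n))\<^sup>2 \<le> M * a (K + n)"
      using step[of "K + n"] K by (simp add: y_def)
    also have "\<dots> \<le> M * (\<sigma> ^ n * a K)"
      using that \<open>0 \<le> M\<close> by (intro mult_left_mono)
    finally have "norm (y (Suc n) - y n) \<le> sqrt (M * (\<sigma> ^ n * a K))"
      by (rule real_le_rsqrt)
    also have "\<dots> = c * s ^ n"
      by (simp add: c_def s_def real_sqrt_mult real_sqrt_power)
    finally show ?thesis .
  qed
  have contr_next: "a (Suc (K + n)) \<le> \<sigma> * a (K + n)" if "\<And>m. m \<le> n \<Longrightarrow> a (K + m) \<le> \<sigma> ^ m * a K" for n
  proof -
    have "norm (y (0 + Suc n) - y 0) \<le> c * s ^ 0 / (1 - s)"
      using s c that by (intro norm_geometric_steps_le) (auto intro!: y_step)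
    also have "\<dots> < \<delta> / 2"
      using c(2) by simp
    finally have "dist (x (Suc (K + n))) (x K) < \<delta> / 2"
      by (simp add: y_def dist_norm)
    then have "dist (x (Suc (K + n))) l < \<delta>"
      using i(2) dist_triangle[of "x (Suc (K + n))" l "x K"] by (simp add: K_def)
    then show ?thesis
      using contr[of "K + n"] K by simp
  qed
  have a_le: "a (K + n) \<le> \<sigma> ^ n * a K" for n
  proof (induction n rule: less_induct)
    case (less n)
    show ?case
    proof (cases n)
      case (Suc m)
      have "a (Suc (K + m)) \<le> \<sigma> * a (K + m)"
        using less Suc by (intro contr_next) auto
      also have "\<dots> \<le> \<sigma> * (\<sigma> ^ m * a K)"
        using less[of m] Suc \<sigma> by (intro mult_left_mono) auto
      finally show ?thesis
        by (simp add: Suc mult.assoc)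
    qed simp
  qed
  \<comment> \<open>Convergence of the whole sequence: the distance from \<open>y n\<close> to
    \<open>l\<close> is the limit of its distances to later subsequence members, all within the
    geometric tail.\<close>
  have y_lim: "norm (y n - l) \<le> c * s ^ n / (1 - s)" for n
  proof (rule LIMSEQ_le_const2)
    show "(\<lambda>i. norm (y n - x (r i))) \<longlonglongrightarrow> norm (y n - l)"
      using r(2) by (intro tendsto_intros) (simp add: o_def)
    have "norm (y n - x (r i)) \<le> c * s ^ n / (1 - s)" if "i \<ge> K + n" for i
    proof -
      define j where "j = r i - (K + n)"
      have "r i = K + (n + j)"
        using that seq_suble[OF r(1), of i] by (simp add: j_def)
      then have "norm (y n - x (r i)) = norm (y (n + j) - y n)"
        by (simp add: y_def norm_minus_commute)
      also have "\<dots> \<le> c * s ^ n / (1 - s)"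
        using s c by (intro norm_geometric_steps_le y_step a_le) auto
      finally show ?thesis .
    qed
    then show "\<exists>N. \<forall>i\<ge>N. norm (y n - x (r i)) \<le> c * s ^ n / (1 - s)"
      by blast
  qed
  \<comment> \<open>Dividing by \<open>s ^ K\<close> converts the exponent \<open>n\<close> into
    \<open>k = K + n\<close>; adding 1 keeps the constant positive even if
    \<open>c = 0\<close>.\<close>
  define \<rho>\<^sub>0 where "\<rho>\<^sub>0 = c / (1 - s) / s ^ K + 1"
  show thesis
  proof (rule that[OF K, of \<rho>\<^sub>0])
    have "0 \<le> c / (1 - s) / s ^ K"
      using c s by simp
    then show "\<rho>\<^sub>0 > 0"
      by (simp add: \<rho>\<^sub>0_def)
    fix k assume "k \<ge> K"
    then obtain n where k: "k = K + n"
      using le_Suc_ex by blast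
    have "norm (x k - l) \<le> c * s ^ n / (1 - s)"
      using y_lim[of n] by (simp add: y_def k)
    also have "\<dots> = c / (1 - s) / s ^ K * s ^ k"
      using s by (simp add: k power_add)
    also have "\<dots> \<le> \<rho>\<^sub>0 * s ^ k"
      using s by (simp add: \<rho>\<^sub>0_def distrib_right)
    finally show "a (Suc k) \<le> \<sigma> * a k \<and> norm (x k - l) \<le> \<rho>\<^sub>0 * sqrt \<sigma> ^ k"
      using contr_next[of n] a_le by (simp add: s_def k)
  qed
qed

theorem theorem4p2:
  fixes f g F :: "real ^ 'n \<Rightarrow> ereal"
    and C :: "(real ^ 'n) set"
    and L \<gamma> F\<^sub>m\<^sub>i\<^sub>n :: real
    and x :: "nat \<Rightarrow> real ^ 'n"
    and xbar :: "real ^ 'n"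
  assumes "proper_fun f" and "lsc_fun f"
    and "proper_fun g" and "lsc_fun g"
    and "F = (\<lambda>x. f x + g x)"
    and "open (edom f)" and "smooth_on_dom f"
    and "closed C" and "convex C" and "edom f \<inter> edom g \<subseteq> C"
    and "L > 0" and "grad_lipschitz_on L C f"
    and "continuous_on (edom g) g"
    and "\<forall>x. F x \<ge> ereal F\<^sub>m\<^sub>i\<^sub>n"
    and "prox_bounded g"
    and "\<gamma> > 0" and "\<gamma> < 1 / L"
    and "PG_sequence f g \<gamma> x"
    and "seq_accumulation_point x xbar"
  shows "xbar \<in> prox_stationary f g \<and>
    (proper_separation f g xbar \<and> calm_at (S_cano f g) 0 xbar
       \<longrightarrow> converges_linearly F x xbar)"
proof -

  \<comment> \<open>Notation, domains and the step estimate\<close>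
  let ?f = "\<lambda>y. real_of_ereal (f y)" and ?g = "\<lambda>y. real_of_ereal (g y)"
  define G where "G = grad f"
  define h where "h = (\<lambda>y. ?f y + ?g y)"
  define c where "c = (1 / \<gamma> - L) / 2"
  note proper = \<open>proper_fun f\<close> \<open>proper_fun g\<close>
  have c: "c > 0"
    using \<open>\<gamma> < 1 / L\<close> \<open>\<gamma> > 0\<close> \<open>L > 0\<close> by (simp add: c_def field_simps)
  have hasG: "has_grad f z (G z)" if "z \<in> C" for z
    using \<open>grad_lipschitz_on L C f\<close> that grad_eq unfolding grad_lipschitz_on_def G_def by metis
  have lip: "L-lipschitz_on C G"
    using \<open>grad_lipschitz_on L C f\<close> by (simp add: grad_lipschitz_on_def G_def)
  have deriv: "GDERIV ?f z :> G z" if "z \<in> C" for z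
    using hasG[OF that] by (simp add: has_grad_def)
  \<comment> \<open>\<open>has_grad\<close> demands an interior point of \<open>edom f\<close>, so
    \<open>C\<close> lies in that domain; with \<open>C\<close> closed, this later places
    \<open>xbar\<close> there.\<close>
  have C_f: "z \<in> edom f" if "z \<in> C" for z
    using hasG[OF that] interior_subset unfolding has_grad_def by blast
  have F: "F z = ereal (h z)" if "z \<in> edom f" "z \<in> edom g" for z
    using that edom_ereal_real[OF proper(1), of z] edom_ereal_real[OF proper(2), of z]
    unfolding \<open>F = _\<close> h_def by (metis plus_ereal.simps(1))

  have prox: "x (Suc k) \<in> Prox g \<gamma> (x k - \<gamma> *\<^sub>R G (x k))" and x_f: "x k \<in> edom f" for k
    using \<open>PG_sequence f g \<gamma> x\<close> by (auto simp: PG_sequence_def G_def)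
  \<comment> \<open>The starting point may lie outside \<open>edom g\<close> and outside \<open>C\<close>, hence the index shift.\<close>
  have x_g: "x k \<in> edom g" if "k \<ge> 1" for k
    using prox[of "k - 1"] that unfolding Prox_iff[OF proper(2)] by simp
  have x_C: "x k \<in> C" if "k \<ge> 1" for k
    using x_f x_g[OF that] \<open>edom f \<inter> edom g \<subseteq> C\<close> by blast
  have step: "h (x (Suc k)) \<le> h y + (1 / \<gamma> + L) / 2 * (norm (y - x k))\<^sup>2
      - c * (norm (x (Suc k) - x k))\<^sup>2" if "k \<ge> 1" "y \<in> C" "y \<in> edom g" for k y
    unfolding h_def c_def
    using that \<open>convex C\<close> deriv lip proper(2) \<open>\<gamma> > 0\<close> prox x_C
    by (intro prox_gradient_step_le) auto
  have descent: "c * (norm (x (Suc k) - x k))\<^sup>2 \<le> h (x k) - h (x (Suc k))" if "k \<ge> 1" for k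
    using step[OF that x_C[OF that] x_g[OF that]] by simp

  \<comment> \<open>Convergence of the values and vanishing steps\<close>
  \<comment> \<open>The shift avoids \<open>h (x 0)\<close>: if \<open>g (x 0)\<close> is infinite,
    \<open>real_of_ereal\<close> replaces it by the default 0.\<close>
  have dec: "decseq (\<lambda>k. h (x (Suc k)))"
  proof (rule decseq_SucI)
    fix k
    have "0 \<le> c * (norm (x (Suc (Suc k)) - x (Suc k)))\<^sup>2"
      using c by simp
    then show "h (x (Suc (Suc k))) \<le> h (x (Suc k))"
      using descent[of "Suc k"] by simp
  qed
  moreover have "F\<^sub>m\<^sub>i\<^sub>n \<le> h (x (Suc k))" for k
    using \<open>\<forall>x. F x \<ge> ereal F\<^sub>m\<^sub>i\<^sub>n\<close>[rule_format, of "x (Suc k)"] F[OF x_f x_g, of "Suc k"] by simp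
  ultimately obtain h_inf where "(\<lambda>k. h (x (Suc k))) \<longlonglongrightarrow> h_inf" and h_ge: "\<And>k. h_inf \<le> h (x (Suc k))"
    using decseq_convergent by blast
  then have h_lim: "(\<lambda>k. h (x k)) \<longlonglongrightarrow> h_inf"
    by (simp add: filterlim_sequentially_Suc[of "\<lambda>k. h (x k)"])
  have steps_0: "(\<lambda>k. norm (x (Suc k) - x k)) \<longlonglongrightarrow> 0"
  proof -
    have "(\<lambda>k. (h (x k) - h (x (Suc k))) / c) \<longlonglongrightarrow> (h_inf - h_inf) / c"
      using c by (intro tendsto_intros h_lim LIMSEQ_Suc) auto
    then have "(\<lambda>k. (h (x k) - h (x (Suc k))) / c) \<longlonglongrightarrow> 0"
      by simp
    moreover have "\<forall>\<^sub>F k in sequentially. norm ((norm (x (Suc k) - x k))\<^sup>2) \<le> (h (x k) - h (x (Suc k))) / c"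
      using eventually_ge_at_top[of 1]
      by eventually_elim (use descent c in \<open>simp add: field_simps\<close>)
    ultimately have "(\<lambda>k. (norm (x (Suc k) - x k))\<^sup>2) \<longlonglongrightarrow> 0"
      by (rule Lim_null_comparison[rotated])
    then have "(\<lambda>k. sqrt ((norm (x (Suc k) - x k))\<^sup>2)) \<longlonglongrightarrow> sqrt 0"
      by (rule tendsto_real_sqrt)
    then show ?thesis by simp
  qed

  \<comment> \<open>Stationarity of the accumulation point\<close>
  obtain r0 where r0: "strict_mono r0" "(x \<circ> r0) \<longlonglongrightarrow> xbar"
    using \<open>seq_accumulation_point x xbar\<close> by (auto simp: seq_accumulation_point_def)
  \<comment> \<open>Dropping the first term ensures \<open>r i \<ge> 1\<close>, so every selected
    iterate lies in \<open>C\<close> and in \<open>edom g\<close>.\<close>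
  define r where "r = r0 \<circ> Suc"
  have r: "strict_mono r"
    using r0(1) unfolding r_def by (intro strict_mono_o) (auto simp: strict_mono_Suc_iff)
  have r_lim: "(\<lambda>i. x (r i)) \<longlonglongrightarrow> xbar"
    using LIMSEQ_Suc[OF r0(2)] by (simp add: r_def o_def)
  have r_1: "r i \<ge> 1" for i
    using seq_suble[OF r0(1), of "Suc i"] by (simp add: r_def)
  have r_filter: "filterlim r at_top sequentially"
    using r by (rule filterlim_subseq)
  have xbar_C: "xbar \<in> C"
    using \<open>closed C\<close> r_lim x_C[OF r_1] by (meson closed_sequentially)
  have xbar_f: "xbar \<in> edom f"
    using xbar_C by (rule C_f)
  \<comment> \<open>The graph of the proximal operator pairs \<open>x (r i)\<close> with its
    successor; vanishing steps give both the same limit.\<close>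
  have r_Suc_lim: "(\<lambda>i. x (Suc (r i))) \<longlonglongrightarrow> xbar"
  proof -
    have "(\<lambda>i. x (Suc (r i)) - x (r i)) \<longlonglongrightarrow> 0"
      using filterlim_compose[OF steps_0 r_filter] by (simp add: tendsto_norm_zero_iff)
    from tendsto_add[OF this r_lim] show ?thesis by simp
  qed
  have G_lim: "(\<lambda>i. G (x (r i))) \<longlonglongrightarrow> G xbar"
    using lipschitz_on_continuous_on[OF lip] xbar_C r_lim x_C[OF r_1]
    by (auto intro: continuous_on_tendsto_compose)
  have xbar_prox: "xbar \<in> Prox g \<gamma> (xbar - \<gamma> *\<^sub>R G xbar)"
    using proper(2) \<open>lsc_fun g\<close> r_Suc_lim
    by (rule Prox_closed_graph[where A = "\<lambda>i. x (r i) - \<gamma> *\<^sub>R G (x (r i))"])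
      (auto intro!: tendsto_intros r_lim G_lim prox)
  have xbar_g: "xbar \<in> edom g"
    using xbar_prox unfolding Prox_iff[OF proper(2)] by blast
  have "- G xbar \<in> prox_subdiff g xbar"
    using Prox_imp_prox_subdiff[OF proper(2) \<open>\<gamma> > 0\<close> xbar_prox] \<open>\<gamma> > 0\<close> by simp
  then have stationary: "xbar \<in> prox_stationary f g"
    unfolding prox_stationary_def using xbar_f by (force simp: G_def)

  \<comment> \<open>Identification of the limit value\<close>
  have "(\<lambda>i. ?f (x (r i))) \<longlonglongrightarrow> ?f xbar"
    using has_derivative_continuous[OF deriv[OF xbar_C, unfolded gderiv_def]] r_lim
    by (rule isCont_tendsto_compose)
  \<comment> \<open>Lower semicontinuity would only bound \<open>h xbar\<close> above by
    \<open>h_inf\<close>; continuity of \<open>g\<close> on its domain yields equality.\<close>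
  moreover have "(\<lambda>i. g (x (r i))) \<longlonglongrightarrow> ereal (?g xbar)"
    unfolding edom_ereal_real[OF proper(2) xbar_g, symmetric]
    using \<open>continuous_on (edom g) g\<close> r_lim xbar_g x_g[OF r_1]
    by (auto intro: continuous_on_tendsto_compose)
  then have "(\<lambda>i. ?g (x (r i))) \<longlonglongrightarrow> ?g xbar"
    by (rule lim_real_of_ereal)
  ultimately have "(\<lambda>i. h (x (r i))) \<longlonglongrightarrow> h xbar"
    unfolding h_def by (rule tendsto_add)
  then have h_inf: "h_inf = h xbar"
    using filterlim_compose[OF h_lim r_filter] by (rule LIMSEQ_unique[rotated])

  \<comment> \<open>Linear convergence under separation and calmness\<close>
  have "converges_linearly F x xbar"
    if sep: "proper_separation f g xbar" and calm: "calm_at (S_cano f g) 0 xbar"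
  proof -
    obtain \<epsilon> where \<epsilon>: "\<epsilon> > 0"
      and "\<And>y. y \<in> prox_stationary f g \<inter> ball xbar \<epsilon> \<Longrightarrow> f y + g y = f xbar + g xbar"
      using sep unfolding proper_separation_def by blast
    then have sep_h: "h y = h xbar" if "y \<in> prox_stationary f g" "y \<in> edom g" "dist y xbar < \<epsilon>" for y
      using F[of y] F[OF xbar_f xbar_g] that
      by (auto simp: \<open>F = _\<close> prox_stationary_def dist_commute)
    obtain \<delta> \<kappa> where \<delta>: "\<delta> > 0" and \<kappa>: "\<kappa> \<ge> 0"
      and calm': "\<And>p z. norm p < \<delta> \<Longrightarrow> dist z xbar < \<delta> \<Longrightarrow> z \<in> S_cano f g p \<Longrightarrow>
        \<exists>y\<in>S_cano f g 0. norm (z - y) \<le> \<kappa> * norm p"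
      using calm_at_error_bound[OF calm] by blast
    \<comment> \<open>The residual: gradient at the new iterate plus the subgradient of
      \<open>g\<close> certified by the proximal step.\<close>
    define p where "p = (\<lambda>k. G (x (Suc k)) + (1 / \<gamma>) *\<^sub>R (x k - \<gamma> *\<^sub>R G (x k) - x (Suc k)))"
    have p_S: "x (Suc k) \<in> S_cano f g (p k)" for k
      using Prox_imp_prox_subdiff[OF proper(2) \<open>\<gamma> > 0\<close> prox[of k]] x_f
      by (auto simp: S_cano_def p_def G_def)
    have p_le: "norm (p k) \<le> (L + 1 / \<gamma>) * norm (x (Suc k) - x k)" if "k \<ge> 1" for k
    proof -
      have "p k = (G (x (Suc k)) - G (x k)) - (1 / \<gamma>) *\<^sub>R (x (Suc k) - x k)"
        using \<open>\<gamma> > 0\<close> by (simp add: p_def algebra_simps)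
      then have "norm (p k) \<le> norm (G (x (Suc k)) - G (x k)) + norm ((1 / \<gamma>) *\<^sub>R (x (Suc k) - x k))"
        by (simp only: norm_triangle_ineq4)
      also have "norm (G (x (Suc k)) - G (x k)) \<le> L * norm (x (Suc k) - x k)"
        using lipschitz_onD[OF lip x_C x_C, of "Suc k" k] that by (simp add: dist_norm)
      finally show ?thesis
        using \<open>\<gamma> > 0\<close> by (simp add: distrib_right)
    qed
    have p_0: "(\<lambda>k. norm (p k)) \<longlonglongrightarrow> 0"
    proof (rule Lim_null_comparison)
      show "\<forall>\<^sub>F k in sequentially. norm (norm (p k)) \<le> (L + 1 / \<gamma>) * norm (x (Suc k) - x k)"
        using eventually_ge_at_top[of 1] by eventually_elim (use p_le in simp)
      show "(\<lambda>k. (L + 1 / \<gamma>) * norm (x (Suc k) - x k)) \<longlonglongrightarrow> 0"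
        using tendsto_mult_left[OF steps_0, of "L + 1 / \<gamma>"] by simp
    qed
    have "(\<lambda>k. \<kappa> * norm (p k)) \<longlonglongrightarrow> 0"
      using tendsto_mult_left[OF p_0, of \<kappa>] by simp
    then have "\<forall>\<^sub>F k in sequentially. \<kappa> * norm (p k) < \<epsilon> / 2"
      using \<epsilon> by (intro order_tendstoD(2)) auto
    moreover have "\<forall>\<^sub>F k in sequentially. norm (p k) < \<delta>"
      using p_0 \<delta> by (intro order_tendstoD(2)) auto
    ultimately have "\<forall>\<^sub>F k in sequentially. \<kappa> * norm (p k) < \<epsilon> / 2 \<and> norm (p k) < \<delta> \<and> k \<ge> 1"
      using eventually_ge_at_top[of 1] by eventually_elim auto
    then obtain N where N: "\<And>k. k \<ge> N \<Longrightarrow> \<kappa> * norm (p k) < \<epsilon> / 2 \<and> norm (p k) < \<delta> \<and> k \<ge> 1"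
      unfolding eventually_sequentially by blast

    \<comment> \<open>The factor \<open>\<kappa> * (L + 1 / \<gamma>) + 1\<close> bounds the
      distance from \<open>x k\<close> to the calmness point \<open>y\<close> in units of the step:
      first \<open>y\<close> to \<open>x (Suc k)\<close>, then the step itself.\<close>
    define A where "A = (1 / \<gamma> + L) / 2 * (\<kappa> * (L + 1 / \<gamma>) + 1)\<^sup>2"
    define q where "q = A / c"
    \<comment> \<open>Obtained by solving \<open>a (Suc k) \<le> q * (a k - a (Suc k))\<close> for
      \<open>a (Suc k)\<close>.\<close>
    define \<sigma> where "\<sigma> = q / (1 + q)"
    have "\<kappa> * (L + 1 / \<gamma>) \<ge> 0"
      using \<kappa> \<open>L > 0\<close> \<open>\<gamma> > 0\<close> by simp
    then have A: "A > 0"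
      unfolding A_def using \<open>L > 0\<close> \<open>\<gamma> > 0\<close> by (intro mult_pos_pos zero_less_power) (auto intro: add_pos_pos)
    then have q: "q > 0"
      using c by (simp add: q_def)
    then have \<sigma>: "0 < \<sigma>" "\<sigma> < 1"
      by (auto simp: \<sigma>_def)
    define a where "a = (\<lambda>k. h (x k) - h xbar)"
    have a_ge: "0 \<le> a k" if "k \<ge> 1" for k
      using h_ge[of "k - 1"] that by (simp add: a_def h_inf)
    \<comment> \<open>Radius \<open>\<delta>\<close> admits calmness; \<open>\<epsilon> / 2\<close>,
      together with \<open>\<kappa> * norm (p k) < \<epsilon> / 2\<close>, keeps \<open>y\<close>
      within the separation radius.\<close>
    have contr: "a (Suc k) \<le> \<sigma> * a k" if k: "k \<ge> N" and near: "dist (x (Suc k)) xbar < min \<delta> (\<epsilon> / 2)" for k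
    proof -
      let ?d = "norm (x (Suc k) - x k)"
      have k1: "k \<ge> 1"
        using N[OF k] by blast
      obtain y where y: "y \<in> S_cano f g 0" and y_le: "norm (x (Suc k) - y) \<le> \<kappa> * norm (p k)"
        using calm'[OF _ _ p_S] N[OF k] near by auto
      have y_stat: "y \<in> prox_stationary f g"
        using y by (simp add: S_cano_def prox_stationary_def)
      have y_dom: "y \<in> edom f" "y \<in> edom g"
        using y by (auto simp: S_cano_def prox_subdiff_def)
      then have y_C: "y \<in> C"
        using \<open>edom f \<inter> edom g \<subseteq> C\<close> by blast
      have "dist y (x (Suc k)) < \<epsilon> / 2"
        using y_le N[OF k] by (simp add: dist_norm norm_minus_commute)
      then have "dist y xbar < \<epsilon>"
        using near dist_triangle[of y xbar "x (Suc k)"] by simp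
      with y_stat y_dom have y_h: "h y = h xbar"
        by (intro sep_h)
      have "norm (y - x k) \<le> norm (x (Suc k) - y) + ?d"
        using norm_triangle_ineq[of "y - x (Suc k)" "x (Suc k) - x k"] by (simp add: norm_minus_commute)
      also have "norm (x (Suc k) - y) \<le> \<kappa> * ((L + 1 / \<gamma>) * ?d)"
        using y_le mult_left_mono[OF p_le[OF k1] \<kappa>] by simp
      finally have "norm (y - x k) \<le> (\<kappa> * (L + 1 / \<gamma>) + 1) * ?d"
        by (simp add: distrib_right mult.assoc)
      then have "(norm (y - x k))\<^sup>2 \<le> (\<kappa> * (L + 1 / \<gamma>) + 1)\<^sup>2 * ?d\<^sup>2"
        by (metis norm_ge_zero power_mono power_mult_distrib)
      then have "(1 / \<gamma> + L) / 2 * (norm (y - x k))\<^sup>2 \<le> A * ?d\<^sup>2"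
        using \<open>L > 0\<close> \<open>\<gamma> > 0\<close> unfolding A_def mult.assoc by (intro mult_left_mono) auto
      moreover have "0 \<le> c * ?d\<^sup>2"
        using c by simp
      ultimately have "a (Suc k) \<le> A * ?d\<^sup>2"
        using step[OF k1 y_C y_dom(2)] unfolding a_def y_h by linarith
      also have "\<dots> = q * (c * ?d\<^sup>2)"
        using c by (simp add: q_def)
      also have "\<dots> \<le> q * (a k - a (Suc k))"
        using descent[OF k1] q by (intro mult_left_mono) (auto simp: a_def)
      finally show ?thesis
        using q by (simp add: \<sigma>_def field_simps)
    qed
    obtain K \<rho>\<^sub>0 where K: "K \<ge> N" "\<rho>\<^sub>0 > 0"
      and linear: "\<And>k. k \<ge> K \<Longrightarrow> a (Suc k) \<le> \<sigma> * a k \<and> norm (x k - xbar) \<le> \<rho>\<^sub>0 * sqrt \<sigma> ^ k"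
    proof (rule local_linear_convergence[where N = N and a = a and x = x and M = "1 / c" and l = xbar
          and \<delta> = "min \<delta> (\<epsilon> / 2)" and \<sigma> = \<sigma> and r = r])
      show "0 \<le> a k" if "k \<ge> N" for k
        using a_ge N[OF that] by blast
      \<comment> \<open>\<open>M = 1 / c\<close> comes from descent after discarding the nonnegative
        \<open>a (Suc k)\<close>.\<close>
      show "(norm (x (Suc k) - x k))\<^sup>2 \<le> 1 / c * a k" if "k \<ge> N" for k
        using descent[of k] a_ge[of "Suc k"] N[OF that] c by (simp add: a_def field_simps)
      show "(a \<circ> r) \<longlonglongrightarrow> 0"
        using \<open>(\<lambda>i. h (x (r i))) \<longlonglongrightarrow> h xbar\<close> unfolding a_def o_def by (rule LIM_zero)
    qed (use contr \<sigma> \<delta> \<epsilon> c r r_lim that in \<open>auto simp: o_def\<close>)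
    have "F (x (Suc k)) - F xbar \<le> ereal \<sigma> * (F (x k) - F xbar)" if "k \<ge> K" for k
    proof -
      have "k \<ge> 1"
        using N[of k] K that by simp
      then show ?thesis
        using linear[OF that] by (simp add: F x_f x_g xbar_f xbar_g a_def)
    qed
    moreover have "K > 0"
      using N[of K] K by simp
    moreover have "0 < sqrt \<sigma>" "sqrt \<sigma> < 1"
      using \<sigma> by auto
    ultimately show ?thesis
      unfolding converges_linearly_def using K \<sigma> linear by blast
  qed
  with stationary show ?thesis
    by blast
qed

end
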